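(* Let $A=A^{1,\dots,k}$ be a multipartition matrix with $k$ partitions and $m$ columns that satisfies the generalized running intersection property (GRIP). Then for every normalized data vector $d$, the maximum likelihood estimate $p^*$ of $d$ in $\mathcal{M}_A$ has $j$-th coordinate $$p^*_j=\frac{1}{c_j}\left(\prod_{\ell=1}^{k}\frac{a^\ell_{\mathcal{S}(\ell,j)}(d)}{\sum_{a^\ell_i\in\mathcal{F}^\ell[\mathcal{S}(\ell,j)]}a^\ell_i(d)}\right),\qquad j\in[m],$$ where $c_j=c^k_j$ is the number of columns of $A$ equal to its $j$-th column.
   Context: Write $[r]=\{1,\dots,r\}$. A partition matrix with $m$ columns is a $0/1$ matrix each of whose columns has exactly one entry equal to $1$; it is assumed to have no zero rows. A multipartition matrix $A=A^{1,\dots,k}$ with $k$ partitions is the matrix obtained by stacking partition matrices $A^1,\dots,A^k$, all with $m$ columns (the ordered list $A^1,\dots,A^k$ is part of the data). Let $n_\ell$ be the number of rows of $A^\ell$, $a^\ell_i$ the $i$-th row of $A^\ell$, $I^\ell_i\subset[m]$ its support, and $\mathcal{S}(\ell,j)\in[n_\ell]$ the unique index with $j\in I^\ell_{\mathcal{S}(\ell,j)}$. $A^{1,\dots,\ell}$ denotes the stacking of the first $\ell$ partitions, and $c^\ell_j$ the number of columns of $A^{1,\dots,\ell}$ equal to its $j$-th column (the $j$-th included). Well-connected: $A$ is well-connected if for every row $a^\ell_u$ with $\ell>1$ one has $c^\ell_j/c^{\ell-1}_j=c^\ell_{j'}/c^{\ell-1}_{j'}$ for all $j,j'\in I^\ell_u$.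 The matrix $\Cup_{n=1}^{\ell}A^n$: let $\beta$ be the number of distinct columns of $A^{1,\dots,\ell}$ and $\lambda:[m]\to[\beta]$ a surjective labeling with $\lambda(j)=\lambda(j')$ iff the $j$-th and $j'$-th columns of $A^{1,\dots,\ell}$ are equal. Then $\Cup_{n=1}^{\ell}A^n$ is the $\beta\times m$ partition matrix whose $j$-th column is the standard basis vector $e_{\lambda(j)}$ (well defined up to permuting rows). Florets: let $B,C$ be partition matrices with $m$ columns; $BC$ denotes $B$ stacked above $C$ (a multipartition matrix with two partitions). A row of $B$ and a row of $C$ are connected if their supports intersect. $B$ and $C$ (or $BC$) satisfy the floret condition if for any two rows of $B$, the sets of rows of $C$ connected to them are disjoint or equal. In that case the set of rows of $C$ connected to a given row of $B$ is called a floret of $C$; let $\mathcal{F}^C_1,\dots,\mathcal{F}^C_f$ be the distinct florets of $C$ (they partition the rows of $C$). Then $B\Cap C$ is the $f\times m$ matrix whose $(t,j)$ entry is $1$ if the row of $C$ having $j$ in its support lies in $\mathcal{F}^C_t$, and $0$ otherwise. GRIP: with $B_\ell=\Cup_{n=1}^{\ell}A^n$, the matrix $A^{1,\dots,k}$ satisfies the GRIP if for each $\ell\in[k-1]$: (1) $B_\ell A^{\ell+1}$ is well-connected; (2) $B_\ell A^{\ell+1}$ satisfies the floret condition; (3) the rows of $B_\ell\Cap A^{\ell+1}$ lie in the (real) rowspan of $A^{1,\dots,\ell}$. Florets of $A$: for $2\le\ell\le k$, $\mathcal{F}^\ell[i]$ denotes the floret of $A^\ell$ containing the row $a^\ell_i$,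 with respect to the pair $B_{\ell-1},A^\ell$. For $\ell=1$, $\mathcal{F}^1[i]$ is the set of all rows of $A^1$. Model and MLE: $\Delta_{m-1}$ is the open probability simplex in $\mathbb{R}^m$ and $\mathcal{M}_A=\{p\in\Delta_{m-1}: \log p\in\mathrm{rowspan}(A)\}$ (coordinatewise log). A normalized data vector is $d\in\Delta_{m-1}$ (strictly positive entries summing to $1$). The maximum likelihood estimate $p^*=p^*(d)$ is the maximizer of $\prod_j p_j^{d_j}$ over $p\in\mathcal{M}_A$. For a row $a$, $a(d)=\sum_j a_jd_j$. *)

theory Defs
  imports Complex_Main "Jordan_Normal_Form.VS_Connect"
begin

text \<open>
  Rows, columns and partitions are numbered from 0: the partition written \<open>A\<^sup>\<ell>\<close> on paper is the
  list element \<open>As ! (\<ell> - 1)\<close>, and \<open>A\<^sup>1\<^sup>,\<^sup>\<dots>\<^sup>,\<^sup>\<ell>\<close> is \<open>stack m (take \<ell> As)\<close>.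
\<close>

subsection \<open>Multipartition matrices\<close>

definition partition_matrix :: "nat \<Rightarrow> real mat \<Rightarrow> bool" where
  "partition_matrix m A \<longleftrightarrow>
     dim_col A = m \<and> elements_mat A \<subseteq> {0, 1} \<and>
     (\<forall>j<m. \<exists>!i. i < dim_row A \<and> A $$ (i, j) = 1) \<and>
     (\<forall>i<dim_row A. row A i \<noteq> 0\<^sub>v m)"

definition multipartition_matrix :: "nat \<Rightarrow> real mat list \<Rightarrow> bool" where
  "multipartition_matrix m As \<longleftrightarrow> As \<noteq> [] \<and> (\<forall>A \<in> set As. partition_matrix m A)"

definition stack :: "nat \<Rightarrow> real mat list \<Rightarrow> real mat" where
  "stack m As = mat_of_rows m (concat (map rows As))"

definition row_support :: "real mat \<Rightarrow> nat \<Rightarrow> nat set" where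
  "row_support A i = {j. j < dim_col A \<and> A $$ (i, j) = 1}"

text \<open>\<open>row_index (As ! (\<ell> - 1)) j\<close> is \<open>\<S>(\<ell>, j)\<close>.\<close>

definition row_index :: "real mat \<Rightarrow> nat \<Rightarrow> nat" where
  "row_index A j = (THE i. i < dim_row A \<and> j \<in> row_support A i)"

text \<open>\<open>col_count (stack m (take \<ell> As)) j\<close> is \<open>c\<^sup>\<ell>\<^sub>j\<close>.\<close>

definition col_count :: "real mat \<Rightarrow> nat \<Rightarrow> nat" where
  "col_count A j = card {j'. j' < dim_col A \<and> col A j' = col A j}"

definition well_connected :: "nat \<Rightarrow> real mat list \<Rightarrow> bool" where
  "well_connected m As \<longleftrightarrow>
     (\<forall>l \<in> {1..<length As}. \<forall>u < dim_row (As ! l).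
        \<forall>j \<in> row_support (As ! l) u. \<forall>j' \<in> row_support (As ! l) u.
          real (col_count (stack m (take (Suc l) As)) j) / real (col_count (stack m (take l As)) j) =
          real (col_count (stack m (take (Suc l) As)) j') / real (col_count (stack m (take l As)) j'))"

text \<open>
  The common refinement \<open>\<Cup>\<^sub>n A\<^sup>n\<close>. It is defined only up to a permutation of its rows; here the
  rows follow the order of the list of distinct columns of the stacked matrix, that is, the
  labeling sends \<open>j\<close> to the position of column \<open>j\<close> in that list. Nothing below depends on this
  choice.
\<close>

definition cup_mat :: "nat \<Rightarrow> real mat list \<Rightarrow> real mat" where
  "cup_mat m As =
     (let cs = remdups (cols (stack m As))
      in mat (length cs) m (\<lambda>(r, j). if cs ! r = col (stack m As) j then 1 else 0))"

subsection \<open>Florets\<close>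

text \<open>A set of rows of \<open>C\<close> is represented by the set of their indices.\<close>

definition connected_rows :: "real mat \<Rightarrow> real mat \<Rightarrow> nat \<Rightarrow> nat set" where
  "connected_rows B C r = {i. i < dim_row C \<and> row_support B r \<inter> row_support C i \<noteq> {}}"

definition floret_condition :: "real mat \<Rightarrow> real mat \<Rightarrow> bool" where
  "floret_condition B C \<longleftrightarrow>
     (\<forall>r < dim_row B. \<forall>s < dim_row B.
        connected_rows B C r \<inter> connected_rows B C s = {} \<or>
        connected_rows B C r = connected_rows B C s)"

definition florets :: "real mat \<Rightarrow> real mat \<Rightarrow> nat set list" where
  "florets B C = remdups (map (connected_rows B C) [0..<dim_row B])"

text \<open>\<open>B \<Cap> C\<close>; meaningful only under the floret condition.\<close>

definition cap_mat :: "real mat \<Rightarrow> real mat \<Rightarrow> real mat" where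
  "cap_mat B C =
     mat (length (florets B C)) (dim_col C)
       (\<lambda>(t, j). if row_index C j \<in> florets B C ! t then 1 else 0)"

text \<open>\<open>floret_of m As l i\<close> is \<open>\<F>\<^sup>l\<^sup>+\<^sup>1[i]\<close>.\<close>

definition floret_of :: "nat \<Rightarrow> real mat list \<Rightarrow> nat \<Rightarrow> nat \<Rightarrow> nat set" where
  "floret_of m As l i =
     (if l = 0 then {..<dim_row (As ! 0)}
      else (THE F. F \<in> set (florets (cup_mat m (take l As)) (As ! l)) \<and> i \<in> F))"

subsection \<open>The generalized running intersection property\<close>

abbreviation rowspan :: "nat \<Rightarrow> real mat \<Rightarrow> real vec set" where
  "rowspan m A \<equiv> vec_space.row_space m A"

definition grip :: "nat \<Rightarrow> real mat list \<Rightarrow> bool" where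
  "grip m As \<longleftrightarrow>
     (\<forall>l \<in> {1..<length As}.
        let B = cup_mat m (take l As); C = As ! l
        in well_connected m [B, C] \<and>
           floret_condition B C \<and>
           set (rows (cap_mat B C)) \<subseteq> rowspan m (stack m (take l As)))"

subsection \<open>The log-linear model and maximum likelihood\<close>

definition open_simplex :: "nat \<Rightarrow> real vec set" where
  "open_simplex m = {p \<in> carrier_vec m. (\<forall>j<m. 0 < p $ j) \<and> (\<Sum>j<m. p $ j) = 1}"

definition model :: "nat \<Rightarrow> real mat list \<Rightarrow> real vec set" where
  "model m As = {p \<in> open_simplex m. map_vec ln p \<in> rowspan m (stack m As)}"

definition likelihood :: "real vec \<Rightarrow> real vec \<Rightarrow> real" where
  "likelihood d p = (\<Prod>j<dim_vec d. (p $ j) powr (d $ j))"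

definition is_mle :: "nat \<Rightarrow> real mat list \<Rightarrow> real vec \<Rightarrow> real vec \<Rightarrow> bool" where
  "is_mle m As d p \<longleftrightarrow> is_arg_max (likelihood d) (\<lambda>q. q \<in> model m As) p"

definition mle :: "nat \<Rightarrow> real mat list \<Rightarrow> real vec \<Rightarrow> real vec" where
  "mle m As d = (THE p. is_mle m As d p)"

end

theory Submission
  imports Defs
begin

text \<open>
  A point \<open>p\<close> of the model with \<open>A p = A d\<close> is the unique maximum likelihood estimate: since
  \<open>log q\<close> lies in the row span, \<open>\<Sum> d\<^sub>j log q\<^sub>j = \<Sum> p\<^sub>j log q\<^sub>j\<close> for every \<open>q\<close> in the model, and Gibbs'
  inequality applies. A vector lies in the row span of the first \<open>l \<ge> 1\<close> partitions iff it is a sum of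
  functions of the individual row indices. For the closed formula, being in the model follows from
  well-connectedness (which makes the ratios of column counts functions of the row index) and from
  the fact that floret indicators lie in the row span of the earlier partitions. The margins are
  matched by induction on the number of partitions: adding one preserves the mass of every class of
  equal columns, and the mass of each row of the new partition is the right share of its floret,
  whose total mass is already correct because its indicator is in the earlier row span.
\<close>

subsection \<open>The closed formula in terms of row labels\<close>

text \<open>The weights over each fibre of \<open>f\<close> add up to 1, so every attained label
  contributes \<open>\<phi> i\<close> exactly once.\<close>

lemma sum_div_card_fibre:
  fixes \<phi> :: "'b \<Rightarrow> real"
  assumes "finite A"
  shows "(\<Sum>x\<in>A. \<phi> (f x) / real (card {y \<in> A. f y = f x})) = (\<Sum>i\<in>f ` A. \<phi> i)"
proof -
  have "(\<Sum>x\<in>A. \<phi> (f x) / real (card {y \<in> A. f y = f x})) =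
    (\<Sum>i\<in>f ` A. \<Sum>x\<in>{x \<in> A. f x = i}. \<phi> (f x) / real (card {y \<in> A. f y = f x}))"
    using assms by (rule sum.image_gen)
  also have "\<dots> = (\<Sum>i\<in>f ` A. \<phi> i)"
  proof (rule sum.cong[OF refl])
    fix i assume "i \<in> f ` A"
    then have "{x \<in> A. f x = i} \<noteq> {}" by auto
    then have "card {x \<in> A. f x = i} \<noteq> 0" using assms by simp
    moreover have "(\<Sum>x\<in>{x \<in> A. f x = i}. \<phi> (f x) / real (card {y \<in> A. f y = f x})) =
      (\<Sum>x\<in>{x \<in> A. f x = i}. \<phi> i / real (card {y \<in> A. f y = i}))"
      by (rule sum.cong) auto
    ultimately show "(\<Sum>x\<in>{x \<in> A. f x = i}. \<phi> (f x) / real (card {y \<in> A. f y = f x})) = \<phi> i"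
      by simp
  qed
  finally show ?thesis .
qed

text \<open>Gibbs' inequality: \<open>ln t \<le> t - 1\<close>, with equality only at
  \<open>t = 1\<close>, is applied to \<open>t = q x / p x\<close> and scaled by \<open>p x\<close>;
  the equal totals make the right-hand sides cancel.\<close>

lemma sum_mult_ln_less:
  fixes p q :: "'a \<Rightarrow> real"
  assumes "finite I" "\<And>x. x \<in> I \<Longrightarrow> 0 < p x" and "\<And>x. x \<in> I \<Longrightarrow> 0 < q x"
    and "sum q I = sum p I" and "x0 \<in> I" "q x0 \<noteq> p x0"
  shows "(\<Sum>x\<in>I. p x * ln (q x)) < (\<Sum>x\<in>I. p x * ln (p x))"
proof -
  have le: "p x * ln (q x) - p x * ln (p x) \<le> q x - p x" if "x \<in> I" for x
  proof -
    have "ln (q x / p x) \<le> q x / p x - 1"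
      using assms that by (intro ln_le_minus_one) simp
    then have "p x * ln (q x / p x) \<le> p x * (q x / p x - 1)"
      using assms(2)[OF that] by simp
    then show ?thesis
      using assms(2,3)[OF that] by (simp add: ln_div right_diff_distrib)
  qed
  have less: "p x0 * ln (q x0) - p x0 * ln (p x0) < q x0 - p x0"
  proof -
    have pos: "0 < p x0" "0 < q x0" using assms by auto
    then have "ln (q x0 / p x0) \<noteq> q x0 / p x0 - 1"
      using assms(6) ln_eq_minus_one[of "q x0 / p x0"] by auto
    moreover have "ln (q x0 / p x0) \<le> q x0 / p x0 - 1"
      using pos by (intro ln_le_minus_one) simp
    ultimately have "p x0 * ln (q x0 / p x0) < p x0 * (q x0 / p x0 - 1)"
      using pos by simp
    then show ?thesis
      using pos by (simp add: ln_div right_diff_distrib)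
  qed
  have "(\<Sum>x\<in>I. p x * ln (q x) - p x * ln (p x)) < (\<Sum>x\<in>I. q x - p x)"
    using assms(1,5) le less by (intro sum_strict_mono_ex1) auto
  then show ?thesis using assms(4) by (simp add: sum_subtractf)
qed

text \<open>
  \<open>S l j\<close> plays the role of \<open>\<S>(l + 1, j)\<close>, and \<open>cell l j\<close> is the class of columns equal to column \<open>j\<close> in
  the first \<open>l\<close> partitions. With \<open>cell 0 j\<close> the set of all columns, the first partition needs no special
  treatment, provided that additive functions are allowed a constant term.
\<close>

locale labelled_data =
  fixes m :: nat and S :: "nat \<Rightarrow> nat \<Rightarrow> nat" and d :: "nat \<Rightarrow> real"
begin

definition cell :: "nat \<Rightarrow> nat \<Rightarrow> nat set" where
  "cell l j = {j'. j' < m \<and> (\<forall>n<l. S n j' = S n j)}"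

text \<open>Indexed by a column rather than by a row: the labels connected to the class of
  \<open>j\<close> in the common refinement. For \<open>l = 0\<close> these are all labels that
  occur, in line with the convention for the first partition.\<close>

definition flo :: "nat \<Rightarrow> nat \<Rightarrow> nat set" where
  "flo l j = S l ` cell l j"

definition marg :: "nat \<Rightarrow> nat \<Rightarrow> real" where
  "marg l i = (\<Sum>j | j < m \<and> S l j = i. d j)"

definition fmarg :: "nat \<Rightarrow> nat \<Rightarrow> real" where
  "fmarg l j = (\<Sum>i\<in>flo l j. marg l i)"

definition est :: "nat \<Rightarrow> nat \<Rightarrow> real" where
  "est l j = 1 / real (card (cell l j)) * (\<Prod>n<l. marg n (S n j) / fmarg n j)"

definition additive :: "nat \<Rightarrow> (nat \<Rightarrow> real) \<Rightarrow> bool" where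
  "additive l f \<longleftrightarrow> (\<exists>c \<theta>. \<forall>j<m. f j = c + (\<Sum>n<l. \<theta> n (S n j)))"

lemma finite_cell [simp]: "finite (cell l j)"
  by (simp add: cell_def)

lemma finite_flo [simp]: "finite (flo l j)"
  by (simp add: flo_def)

lemma cell_0 [simp]: "cell 0 j = {..<m}"
  by (auto simp: cell_def)

lemma self_in_cell: "j < m \<Longrightarrow> j \<in> cell l j"
  by (simp add: cell_def)

lemma card_cell_pos: "j < m \<Longrightarrow> 0 < card (cell l j)"
  using self_in_cell by (auto simp: card_gt_0_iff)

lemma cell_eq: "j' \<in> cell l j \<Longrightarrow> cell l j' = cell l j"
  by (auto simp: cell_def)

lemma cell_antimono: "l \<le> l' \<Longrightarrow> cell l' j \<subseteq> cell l j"
  by (auto simp: cell_def)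

lemma cell_Suc: "cell (Suc l) j = {j' \<in> cell l j. S l j' = S l j}"
  by (auto simp: cell_def less_Suc_eq)

lemma flo_cong: "j' \<in> cell l j \<Longrightarrow> flo l j' = flo l j"
  by (simp add: flo_def cell_eq)

lemma fmarg_cong: "j' \<in> cell l j \<Longrightarrow> fmarg l j' = fmarg l j"
  by (simp add: fmarg_def flo_cong)

text \<open>The factor for \<open>n < l\<close> depends only on \<open>S n\<close> and on the cell
  at level \<open>n\<close>, and both are constant on the finer cell at level
  \<open>l\<close>.\<close>

lemma est_cong:
  assumes "j' \<in> cell l j"
  shows "est l j' = est l j"
proof -
  have "(\<Prod>n<l. marg n (S n j') / fmarg n j') = (\<Prod>n<l. marg n (S n j) / fmarg n j)"
  proof (rule prod.cong[OF refl])
    fix n assume n: "n \<in> {..<l}"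
    then have "j' \<in> cell n j" using assms cell_antimono[of n l j] by auto
    then show "marg n (S n j') / fmarg n j' = marg n (S n j) / fmarg n j"
      using assms n by (simp add: fmarg_cong) (simp add: cell_def)
  qed
  then show ?thesis using assms by (simp add: est_def cell_eq)
qed

text \<open>Separates the ratio of cell sizes, controlled by well-connectedness, from the ratio of
  margins.\<close>

lemma est_Suc:
  assumes "j < m"
  shows "est (Suc l) j = est l j * (real (card (cell l j)) / real (card (cell (Suc l) j))) *
    (marg l (S l j) / fmarg l j)"
  using self_in_cell[OF assms, of l] by (auto simp: est_def)

text \<open>
  Passing from \<open>l\<close> to \<open>Suc l\<close> redistributes the mass of each cell over the rows of its floret,
  proportionally to their margins. The cell sizes in the estimate turn the sum over a cell into a
  sum over the labels that occur in it.
\<close>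

lemma sum_est_Suc:
  assumes g: "\<And>j j'. j < m \<Longrightarrow> j' \<in> cell l j \<Longrightarrow> g j' = g j"
  shows "(\<Sum>j<m. g j * \<theta> (S l j) * est (Suc l) j) =
    (\<Sum>j<m. g j * est l j * ((\<Sum>i\<in>flo l j. \<theta> i * marg l i) / fmarg l j))"
proof -
  \<comment> \<open>\<open>h j\<close> is the left summand divided by
    \<open>card (cell l j)\<close>, so adding it up over the cell restores the summand.\<close>
  define h where "h j = g j * est l j * (\<theta> (S l j) * marg l (S l j) / fmarg l j) /
    real (card (cell (Suc l) j))" for j
  have "(\<Sum>j<m. g j * \<theta> (S l j) * est (Suc l) j) = (\<Sum>j<m. \<Sum>j'\<in>cell l j. h j)"
    by (rule sum.cong) (simp_all add: est_Suc h_def ac_simps)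
  \<comment> \<open>Lying in the same cell is a symmetric relation, so exchanging the two sums
    averages \<open>h\<close> over each cell.\<close>
  also have "\<dots> = (\<Sum>j<m. \<Sum>j'\<in>cell l j. h j')"
  proof -
    have "(\<Sum>j<m. \<Sum>j'\<in>cell l j. h j) = (\<Sum>j<m. \<Sum>j'\<in>{j' \<in> {..<m}. j' \<in> cell l j}. h j)"
      by (intro sum.cong) (auto simp: cell_def)
    also have "\<dots> = (\<Sum>j'<m. \<Sum>j\<in>{j \<in> {..<m}. j' \<in> cell l j}. h j)"
      by (rule sum.swap_restrict) auto
    also have "\<dots> = (\<Sum>j'<m. \<Sum>j\<in>cell l j'. h j)"
      by (intro sum.cong) (auto simp: cell_def)
    finally show ?thesis .
  qed
  also have "\<dots> = (\<Sum>j<m. g j * est l j * ((\<Sum>i\<in>flo l j. \<theta> i * marg l i) / fmarg l j))"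
  proof (rule sum.cong[OF refl])
    fix j assume "j \<in> {..<m}"
    then have j: "j < m" by simp
    \<comment> \<open>On a cell \<open>g\<close>, \<open>est l\<close> and \<open>fmarg l\<close>
      are constant, and the next finer cells are the fibres of \<open>S l\<close>.\<close>
    have "(\<Sum>j'\<in>cell l j. h j') =
      (\<Sum>j'\<in>cell l j. g j * est l j / fmarg l j *
        (\<theta> (S l j') * marg l (S l j') / real (card {y \<in> cell l j. S l y = S l j'})))"
    proof (rule sum.cong[OF refl])
      fix j' assume j': "j' \<in> cell l j"
      show "h j' = g j * est l j / fmarg l j *
        (\<theta> (S l j') * marg l (S l j') / real (card {y \<in> cell l j. S l y = S l j'}))"
        by (simp add: h_def g[OF j j'] est_cong[OF j'] fmarg_cong[OF j'] cell_Suc cell_eq[OF j'])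
    qed
    also have "\<dots> = g j * est l j / fmarg l j * (\<Sum>i\<in>flo l j. \<theta> i * marg l i)"
      unfolding sum_distrib_left[symmetric] flo_def
      using sum_div_card_fibre[of "cell l j" "\<lambda>i. \<theta> i * marg l i" "S l"] by simp
    finally show "(\<Sum>j'\<in>cell l j. h j') =
        g j * est l j * ((\<Sum>i\<in>flo l j. \<theta> i * marg l i) / fmarg l j)"
      by simp
  qed
  finally show ?thesis .
qed

text \<open>Writes a total margin as a pairing of an indicator with \<open>d\<close>, the form in
  which the induction on levels delivers floret masses.\<close>

lemma sum_marg:
  assumes "finite F"
  shows "(\<Sum>i\<in>F. marg l i) = (\<Sum>j<m. (if S l j \<in> F then 1 else 0) * d j)"
proof -
  have "(\<Sum>i\<in>F. marg l i) = (\<Sum>i\<in>F. \<Sum>j\<in>{j \<in> {j. j < m \<and> S l j \<in> F}. S l j = i}. d j)"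
    unfolding marg_def by (intro sum.cong) auto
  also have "\<dots> = (\<Sum>j | j < m \<and> S l j \<in> F. d j)"
    using assms by (intro sum.group) auto
  also have "\<dots> = (\<Sum>j<m. if S l j \<in> F then d j else 0)"
    by (simp add: sum.If_cases Int_def)
  also have "\<dots> = (\<Sum>j<m. (if S l j \<in> F then 1 else 0) * d j)"
    by (intro sum.cong) auto
  finally show ?thesis .
qed

text \<open>Reduces matching sums of arbitrary functions of a label to matching the mass of each
  single row.\<close>

lemma sum_by_label:
  "(\<Sum>j<m. \<theta> (S l j) * x j) = (\<Sum>i\<in>S l ` {..<m}. \<theta> i * (\<Sum>j<m. (if S l j = i then 1 else 0) * (x j :: real)))"
proof -
  have "(\<Sum>i\<in>S l ` {..<m}. \<theta> i * (\<Sum>j<m. (if S l j = i then 1 else 0) * x j)) =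
    (\<Sum>i\<in>S l ` {..<m}. \<Sum>j<m. \<theta> i * ((if S l j = i then 1 else 0) * x j))"
    by (simp add: sum_distrib_left)
  also have "\<dots> = (\<Sum>j<m. \<Sum>i\<in>S l ` {..<m}. \<theta> i * ((if S l j = i then 1 else 0) * x j))"
    by (rule sum.swap)
  also have "\<dots> = (\<Sum>j<m. \<theta> (S l j) * x j)"
  proof (rule sum.cong[OF refl])
    fix j assume j: "j \<in> {..<m}"
    have "(\<Sum>i\<in>S l ` {..<m}. \<theta> i * ((if S l j = i then 1 else 0) * x j)) =
      (\<Sum>i\<in>S l ` {..<m}. if i = S l j then \<theta> i * x j else 0)"
      by (intro sum.cong) auto
    also have "\<dots> = \<theta> (S l j) * x j" using j by simp
    finally show "(\<Sum>i\<in>S l ` {..<m}. \<theta> i * ((if S l j = i then 1 else 0) * x j)) = \<theta> (S l j) * x j" .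
  qed
  finally show ?thesis by simp
qed

section \<open>Closure properties of additive functions\<close>

lemma additive_cong: "(\<And>j. j < m \<Longrightarrow> f j = g j) \<Longrightarrow> additive l f \<longleftrightarrow> additive l g"
  by (simp add: additive_def)

lemma additive_const: "additive l (\<lambda>j. c)"
  unfolding additive_def by (rule exI[of _ c], rule exI[of _ "\<lambda>_ _. 0"]) simp

lemma additive_add:
  assumes "additive l f" "additive l g"
  shows "additive l (\<lambda>j. f j + g j)"
proof -
  obtain c \<theta> c' \<theta>' where "\<forall>j<m. f j = c + (\<Sum>n<l. \<theta> n (S n j))"
    "\<forall>j<m. g j = c' + (\<Sum>n<l. \<theta>' n (S n j))"
    using assms unfolding additive_def by blast
  then have "\<forall>j<m. f j + g j = (c + c') + (\<Sum>n<l. \<theta> n (S n j) + \<theta>' n (S n j))"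
    by (simp add: sum.distrib)
  then show ?thesis
    unfolding additive_def by (intro exI[of _ "c + c'"] exI[of _ "\<lambda>n i. \<theta> n i + \<theta>' n i"])
qed

lemma additive_scale:
  assumes "additive l f"
  shows "additive l (\<lambda>j. a * f j)"
proof -
  obtain c \<theta> where "\<forall>j<m. f j = c + (\<Sum>n<l. \<theta> n (S n j))"
    using assms unfolding additive_def by blast
  then have "\<forall>j<m. a * f j = a * c + (\<Sum>n<l. a * \<theta> n (S n j))"
    by (simp add: distrib_left sum_distrib_left)
  then show ?thesis
    unfolding additive_def by (intro exI[of _ "a * c"] exI[of _ "\<lambda>n i. a * \<theta> n i"])
qed

lemma additive_sum:
  "finite I \<Longrightarrow> (\<And>x. x \<in> I \<Longrightarrow> additive l (f x)) \<Longrightarrow> additive l (\<lambda>j. \<Sum>x\<in>I. f x j)"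
  by (induction I rule: finite_induct) (simp_all add: additive_const additive_add)

lemma additive_Suc:
  assumes "additive l f"
  shows "additive (Suc l) (\<lambda>j. f j + \<phi> (S l j))"
proof -
  obtain c \<theta> where "\<forall>j<m. f j = c + (\<Sum>n<l. \<theta> n (S n j))"
    using assms unfolding additive_def by blast
  then have "\<forall>j<m. f j + \<phi> (S l j) = c + (\<Sum>n<Suc l. (\<theta>(l := \<phi>)) n (S n j))"
    by simp
  then show ?thesis unfolding additive_def by blast
qed

end

section \<open>Margins, model membership and optimality under the GRIP\<close>

locale grip_data = labelled_data +
  fixes k :: nat
  assumes d_pos: "j < m \<Longrightarrow> 0 < d j"
    and d_sum: "(\<Sum>j<m. d j) = 1"
    \<comment> \<open>These three are the floret condition, well-connectedness and the row span
      condition, in terms of labels. They include \<open>l = 0\<close>, where they hold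
      automatically.\<close>
    and flo_disj: "\<lbrakk>l < k; j < m; j' < m\<rbrakk> \<Longrightarrow> flo l j \<inter> flo l j' = {} \<or> flo l j = flo l j'"
    and card_ratio: "\<lbrakk>l < k; j < m; j' < m; S l j = S l j'\<rbrakk> \<Longrightarrow>
      real (card (cell (Suc l) j)) / real (card (cell l j)) =
      real (card (cell (Suc l) j')) / real (card (cell l j'))"
    and flo_additive: "\<lbrakk>l < k; j' < m\<rbrakk> \<Longrightarrow>
      additive l (\<lambda>j. if S l j \<in> flo l j' then 1 else 0)"
begin

text \<open>A column lies in its own cell, so \<open>S l j\<close> is in \<open>flo l j\<close>; by
  disjointness the label determines its floret.\<close>

lemma in_flo_iff:
  assumes "l < k" "j < m" "j' < m"
  shows "S l j \<in> flo l j' \<longleftrightarrow> flo l j = flo l j'"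
  using flo_disj[OF assms] self_in_cell[OF assms(2), of l] by (auto simp: flo_def)

lemma marg_pos: "j < m \<Longrightarrow> 0 < marg l (S l j)"
  unfolding marg_def using d_pos by (intro sum_pos) auto

lemma fmarg_pos: "j < m \<Longrightarrow> 0 < fmarg l j"
  unfolding fmarg_def flo_def using self_in_cell[of j l]
  by (intro sum_pos) (auto intro!: marg_pos simp: cell_def)

lemma est_pos:
  assumes "j < m"
  shows "0 < est l j"
  unfolding est_def
  using assms card_cell_pos[OF assms, of l]
  by (auto intro!: mult_pos_pos prod_pos divide_pos_pos marg_pos fmarg_pos)

text \<open>Ranging over all additive \<open>f\<close>, and not only over row indicators, lets the
  induction hypothesis apply to floret indicators, which are additive one level down by
  \<open>flo_additive\<close>.\<close>

lemma est_margins: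
  "l \<le> k \<Longrightarrow> additive l f \<Longrightarrow> (\<Sum>j<m. f j * est l j) = (\<Sum>j<m. f j * d j)"
proof (induction l arbitrary: f)
  case 0
  \<comment> \<open>At level 0 additive functions are constant and the estimate is uniform.\<close>
  then obtain c where c: "\<And>j. j < m \<Longrightarrow> f j = c" by (auto simp: additive_def)
  have "m \<noteq> 0" using d_sum by (intro notI) simp
  have "(\<Sum>j<m. f j * est 0 j) = (\<Sum>j<m. c * (1 / real m))"
    by (intro sum.cong) (auto simp: c est_def)
  also have "\<dots> = c" using \<open>m \<noteq> 0\<close> by simp
  also have "\<dots> = c * (\<Sum>j<m. d j)" by (simp add: d_sum)
  also have "\<dots> = (\<Sum>j<m. f j * d j)" by (simp add: c sum_distrib_left)
  finally show ?case .
next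
  case (Suc l)
  then have l: "l < k" by simp
  obtain c \<theta> where f: "\<And>j. j < m \<Longrightarrow> f j = c + (\<Sum>n<Suc l. \<theta> n (S n j))"
    using Suc.prems(2) unfolding additive_def by blast
  \<comment> \<open>\<open>g\<close> is the part of \<open>f\<close> seen by the first
    \<open>l\<close> partitions; it is constant on cells, and the rest depends on \<open>S l\<close>
    alone.\<close>
  define g where "g j = c + (\<Sum>n<l. \<theta> n (S n j))" for j
  have g: "g j' = g j" if "j' \<in> cell l j" for j j'
    using that by (auto simp: g_def cell_def)
  have split: "(\<Sum>j<m. f j * x j) = (\<Sum>j<m. g j * x j) + (\<Sum>j<m. \<theta> l (S l j) * x j)" for x
    unfolding sum.distrib[symmetric] by (intro sum.cong) (auto simp: f g_def algebra_simps)
  have "(\<Sum>j<m. g j * est (Suc l) j) = (\<Sum>j<m. g j * est l j)"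
  proof -
    \<comment> \<open>With \<open>\<theta> = 1\<close> the redistribution factor is
      \<open>fmarg / fmarg\<close>: the mass of every cell is preserved.\<close>
    have "(\<Sum>j<m. g j * est (Suc l) j) = (\<Sum>j<m. g j * est l j * (fmarg l j / fmarg l j))"
      using sum_est_Suc[of l g "\<lambda>_. 1"] g by (simp add: fmarg_def)
    also have "\<dots> = (\<Sum>j<m. g j * est l j)"
      using fmarg_pos by (intro sum.cong) (auto simp: less_imp_neq[symmetric])
    finally show ?thesis .
  qed
  also have "\<dots> = (\<Sum>j<m. g j * d j)"
    using l by (intro Suc.IH) (auto simp: additive_def g_def)
  finally have 1: "(\<Sum>j<m. g j * est (Suc l) j) = (\<Sum>j<m. g j * d j)" .
  have "(\<Sum>j<m. (if S l j = i then 1 else 0) * est (Suc l) j) =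
      (\<Sum>j<m. (if S l j = i then 1 else 0) * d j)" if "i \<in> S l ` {..<m}" for i
  proof -
    obtain j' where j': "j' < m" "i = S l j'" using \<open>i \<in> S l ` {..<m}\<close> by auto
    have "(\<Sum>j<m. (if S l j = i then 1 else 0) * est (Suc l) j) =
      (\<Sum>j<m. est l j * ((\<Sum>i'\<in>flo l j. (if i' = i then 1 else 0) * marg l i') / fmarg l j))"
      using sum_est_Suc[of l "\<lambda>_. 1" "\<lambda>i'. if i' = i then 1 else 0"] by simp
    \<comment> \<open>A column contributes only if its floret is the one containing
      \<open>i\<close>, and its floret margin is then the constant
      \<open>fmarg l j'\<close>.\<close>
    also have "\<dots> = (\<Sum>j<m. marg l i / fmarg l j' * ((if S l j \<in> flo l j' then 1 else 0) * est l j))"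
    proof (rule sum.cong[OF refl])
      fix j assume "j \<in> {..<m}"
      then have j: "j < m" by simp
      have "(\<Sum>i'\<in>flo l j. (if i' = i then 1 else 0) * marg l i') =
        (\<Sum>i'\<in>flo l j. if i' = i then marg l i' else 0)" by (intro sum.cong) auto
      also have "\<dots> = (if i \<in> flo l j then marg l i else 0)" by simp
      finally have *: "(\<Sum>i'\<in>flo l j. (if i' = i then 1 else 0) * marg l i') =
        (if i \<in> flo l j then marg l i else 0)" .
      have "i \<in> flo l j \<longleftrightarrow> flo l j = flo l j'" "S l j \<in> flo l j' \<longleftrightarrow> flo l j = flo l j'"
        using in_flo_iff[OF l j'(1) j] in_flo_iff[OF l j j'(1)] j'(2) by auto
      then show "est l j * ((\<Sum>i'\<in>flo l j. (if i' = i then 1 else 0) * marg l i') / fmarg l j) =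
        marg l i / fmarg l j' * ((if S l j \<in> flo l j' then 1 else 0) * est l j)"
        unfolding * by (auto simp: fmarg_def)
    qed
    also have "\<dots> = marg l i / fmarg l j' * (\<Sum>j<m. (if S l j \<in> flo l j' then 1 else 0) * est l j)"
      by (rule sum_distrib_left[symmetric])
    \<comment> \<open>The induction hypothesis, used for the floret indicator, says that the
      estimate already gives the floret its correct mass.\<close>
    also have "(\<Sum>j<m. (if S l j \<in> flo l j' then 1 else 0) * est l j) =
      (\<Sum>j<m. (if S l j \<in> flo l j' then 1 else 0) * d j)"
      using l j' by (intro Suc.IH flo_additive) auto
    also have "\<dots> = fmarg l j'"
      unfolding fmarg_def by (rule sum_marg[symmetric]) simp
    also have "marg l i / fmarg l j' * fmarg l j' = marg l i"
      using fmarg_pos[OF j'(1), of l] by simp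
    also have "\<dots> = (\<Sum>j<m. (if S l j = i then 1 else 0) * d j)"
      using sum_marg[of "{i}" l] by simp
    finally show ?thesis .
  qed
  then have 2: "(\<Sum>j<m. \<theta> l (S l j) * est (Suc l) j) = (\<Sum>j<m. \<theta> l (S l j) * d j)"
    unfolding sum_by_label[of "\<theta> l" l] by (intro sum.cong) auto
  show ?case unfolding split 1 2 ..
qed

lemma est_sum:
  assumes "l \<le> k"
  shows "(\<Sum>j<m. est l j) = 1"
  using est_margins[OF assms additive_const[of l 1]] d_sum by simp

text \<open>Each column's label lies in exactly one floret, so a function of the floret is a linear
  combination of floret indicators.\<close>

lemma additive_fmarg:
  assumes l: "l < k"
  shows "additive l (\<lambda>j. \<phi> (flo l j))"
proof -
  have "additive l (\<lambda>j. \<Sum>F\<in>flo l ` {..<m}. \<phi> F * (if S l j \<in> F then 1 else 0))"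
    using l by (intro additive_sum) (auto intro!: additive_scale flo_additive)
  moreover have "(\<Sum>F\<in>flo l ` {..<m}. \<phi> F * (if S l j \<in> F then 1 else 0)) = \<phi> (flo l j)"
    if j: "j < m" for j
  proof -
    have "(\<Sum>F\<in>flo l ` {..<m}. \<phi> F * (if S l j \<in> F then 1 else 0)) =
      (\<Sum>F\<in>flo l ` {..<m}. if F = flo l j then \<phi> F else 0)"
      using in_flo_iff[OF l j] by (intro sum.cong) auto
    also have "\<dots> = \<phi> (flo l j)" using j by simp
    finally show ?thesis .
  qed
  ultimately show ?thesis by (simp cong: additive_cong)
qed

text \<open>Up to logarithms, the new factor splits into a function of the label
  \<open>S l j\<close> (cell ratio and row margin) and the floret margin, which is additive at level
  \<open>l\<close>.\<close>

lemma additive_ln_est: "l \<le> k \<Longrightarrow> additive l (\<lambda>j. ln (est l j))"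
proof (induction l)
  case 0
  show ?case by (simp add: est_def additive_const)
next
  case (Suc l)
  then have l: "l < k" by simp
  \<comment> \<open>The cell ratio is only known to be constant for each label; a chosen
    representative column turns it into a function of the label.\<close>
  define rep where "rep i = (SOME j. j < m \<and> S l j = i)" for i
  define \<phi> where "\<phi> i = ln (real (card (cell l (rep i))) / real (card (cell (Suc l) (rep i)))) +
    ln (marg l i)" for i
  have *: "ln (est (Suc l) j) =
      (ln (est l j) + - 1 * (\<lambda>F. ln (\<Sum>i\<in>F. marg l i)) (flo l j)) + \<phi> (S l j)"
    if j: "j < m" for j
  proof -
    have rep: "rep (S l j) < m \<and> S l (rep (S l j)) = S l j"
      unfolding rep_def by (rule someI[of _ j]) (simp add: j)
    have "inverse (real (card (cell (Suc l) j)) / real (card (cell l j))) =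
      inverse (real (card (cell (Suc l) (rep (S l j)))) / real (card (cell l (rep (S l j)))))"
      using card_ratio[OF l j, of "rep (S l j)"] rep by simp
    then have ratio: "real (card (cell l j)) / real (card (cell (Suc l) j)) =
      real (card (cell l (rep (S l j)))) / real (card (cell (Suc l) (rep (S l j))))"
      by simp
    have "ln (e * r * (a / b)) = ln e + (ln r + ln a) - ln b"
      if "0 < e" "0 < r" "0 < a" "0 < b" for e r a b :: real
      using that by (simp add: ln_mult_pos ln_div)
    from this[of "est l j" "real (card (cell l j)) / real (card (cell (Suc l) j))"
        "marg l (S l j)" "fmarg l j"]
    have "ln (est (Suc l) j) = ln (est l j) + \<phi> (S l j) - ln (fmarg l j)"
      using est_pos[OF j, of l] card_cell_pos[OF j, of l] card_cell_pos[OF j, of "Suc l"]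
        marg_pos[OF j, of l] fmarg_pos[OF j, of l]
      unfolding est_Suc[OF j] \<phi>_def ratio[symmetric] by simp
    then show ?thesis by (simp add: fmarg_def)
  qed
  have "additive (Suc l) (\<lambda>j. (ln (est l j) +
      - 1 * (\<lambda>F. ln (\<Sum>i\<in>F. marg l i)) (flo l j)) + \<phi> (S l j))"
    using l Suc.IH by (intro additive_Suc additive_add additive_scale additive_fmarg) auto
  then show ?case using * by (simp cong: additive_cong)
qed

text \<open>Both logarithms are additive, so \<open>est_margins\<close> replaces the weights
  \<open>d\<close> by \<open>est k\<close> on both sides, leaving Gibbs' inequality.\<close>

lemma est_maximises:
  assumes q: "\<And>j. j < m \<Longrightarrow> 0 < q j" "(\<Sum>j<m. q j) = 1" "additive k (\<lambda>j. ln (q j))"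
    and "j0 < m" "q j0 \<noteq> est k j0"
  shows "(\<Sum>j<m. d j * ln (q j)) < (\<Sum>j<m. d j * ln (est k j))"
proof -
  have "(\<Sum>j<m. est k j * ln (q j)) < (\<Sum>j<m. est k j * ln (est k j))"
    using assms by (intro sum_mult_ln_less[of _ _ _ j0]) (auto simp: est_pos est_sum)
  then show ?thesis
    using est_margins[OF order_refl q(3)] est_margins[OF order_refl additive_ln_est[OF order_refl]]
    by (simp add: mult.commute)
qed

end

subsection \<open>Partition matrices and their stacks\<close>

lemma
  assumes "partition_matrix m A" "j < m"
  shows row_index_less: "row_index A j < dim_row A"
    and partition_matrix_entry:
      "i < dim_row A \<Longrightarrow> A $$ (i, j) = (if row_index A j = i then 1 else 0)"
proof -
  have eq: "dim_col A = m" and ex: "\<exists>!i. i < dim_row A \<and> A $$ (i, j) = 1"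
    using assms by (auto simp: partition_matrix_def)
  have *: "i < dim_row A \<and> j \<in> row_support A i \<longleftrightarrow> i < dim_row A \<and> A $$ (i, j) = 1" for i
    using eq assms(2) by (auto simp: row_support_def)
  have ri: "row_index A j < dim_row A \<and> A $$ (row_index A j, j) = 1"
    unfolding row_index_def * using ex by (rule theI')
  then show "row_index A j < dim_row A" by simp
  assume i: "i < dim_row A"
  have "A $$ (i, j) \<in> elements_mat A"
    using i eq assms(2) by (intro elements_matI[of A "dim_row A" "dim_col A" i j]) auto
  then have "A $$ (i, j) = 0 \<or> A $$ (i, j) = 1"
    using assms(1) by (auto simp: partition_matrix_def)
  then show "A $$ (i, j) = (if row_index A j = i then 1 else 0)"
    using ex ri i by auto
qed

lemma row_support_partition_matrix:
  assumes "partition_matrix m A" "i < dim_row A"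
  shows "row_support A i = {j. j < m \<and> row_index A j = i}"
proof -
  have "dim_col A = m" using assms(1) by (simp add: partition_matrix_def)
  then show ?thesis
    using partition_matrix_entry[OF assms(1)] assms(2)
    by (auto simp: row_support_def split: if_splits)
qed

text \<open>The absence of zero rows gives surjectivity.\<close>

lemma row_index_image:
  assumes "partition_matrix m A"
  shows "row_index A ` {..<m} = {..<dim_row A}"
proof (intro equalityI subsetI)
  fix i assume i: "i \<in> {..<dim_row A}"
  then have "row A i \<noteq> 0\<^sub>v m" "dim_col A = m" using assms by (auto simp: partition_matrix_def)
  then obtain j where j: "j < m" "A $$ (i, j) \<noteq> 0"
    using i by (auto simp: vec_eq_iff)
  then have "row_index A j = i"
    using partition_matrix_entry[OF assms j(1), of i] i by (simp split: if_splits)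
  then show "i \<in> row_index A ` {..<m}" using j(1) by auto
qed (auto simp: row_index_less[OF assms])

lemma row_scalar_prod_partition_matrix:
  assumes "partition_matrix m A" "i < dim_row A" "d \<in> carrier_vec m"
  shows "row A i \<bullet> d = (\<Sum>j | j < m \<and> row_index A j = i. d $ j)"
proof -
  have dim: "dim_col A = m" using assms(1) by (simp add: partition_matrix_def)
  have "row A i \<bullet> d = (\<Sum>j<m. if row_index A j = i then d $ j else 0)"
    unfolding scalar_prod_def
    using assms dim by (intro sum.cong) (auto simp: partition_matrix_entry[OF assms(1)])
  then show ?thesis by (simp add: sum.If_cases Int_def)
qed

lemma stack_simps [simp]:
  "dim_col (stack m As) = m" "dim_row (stack m As) = length (concat (map rows As))"
  by (simp_all add: stack_def)

lemma set_rows_stack: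
  assumes "\<forall>A\<in>set As. partition_matrix m A"
  shows "set (rows (stack m As)) = (\<Union>A\<in>set As. row A ` {..<dim_row A})"
proof -
  have "set (concat (map rows As)) = (\<Union>A\<in>set As. row A ` {..<dim_row A})"
    by (auto simp: rows_def)
  moreover have "set (concat (map rows As)) \<subseteq> carrier_vec m"
    using assms by (auto simp: rows_def partition_matrix_def)
  ultimately show ?thesis by (simp add: stack_def)
qed

text \<open>A column of a partition matrix is a standard basis vector, determined by the position of
  its 1.\<close>

lemma col_stack_eq_iff:
  assumes "\<forall>A\<in>set As. partition_matrix m A" "j < m" "j' < m"
  shows "col (stack m As) j = col (stack m As) j' \<longleftrightarrow>
    (\<forall>A\<in>set As. row_index A j = row_index A j')"
proof -
  have "col (stack m As) j = col (stack m As) j' \<longleftrightarrow>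
    (\<forall>r\<in>set (rows (stack m As)). r $ j = r $ j')"
    using assms(2,3) by (auto simp: vec_eq_iff rows_def)
  also have "\<dots> \<longleftrightarrow> (\<forall>A\<in>set As. \<forall>i<dim_row A. row A i $ j = row A i $ j')"
    unfolding set_rows_stack[OF assms(1)] by auto
  also have "\<dots> \<longleftrightarrow> (\<forall>A\<in>set As. row_index A j = row_index A j')"
  proof (intro ball_cong refl)
    fix A assume "A \<in> set As"
    then have A: "partition_matrix m A" "dim_col A = m"
      using assms(1) by (auto simp: partition_matrix_def)
    have row: "row A i $ j = row A i $ j' \<longleftrightarrow> (row_index A j = i \<longleftrightarrow> row_index A j' = i)"
      if "i < dim_row A" for i
      using that assms(2,3) A(2) partition_matrix_entry[OF A(1) assms(2) that]
        partition_matrix_entry[OF A(1) assms(3) that] by simp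
    show "(\<forall>i<dim_row A. row A i $ j = row A i $ j') \<longleftrightarrow> row_index A j = row_index A j'"
      using row row_index_less[OF A(1) assms(2)] by metis
  qed
  finally show ?thesis .
qed

lemma col_count_stack:
  assumes "\<forall>A\<in>set As. partition_matrix m A" "j < m"
  shows "col_count (stack m As) j =
    card {j'. j' < m \<and> (\<forall>A\<in>set As. row_index A j' = row_index A j)}"
  unfolding col_count_def using col_stack_eq_iff[OF assms(1) _ assms(2)]
  by (intro arg_cong[where f = card]) auto

text \<open>The row index of \<open>j\<close> is the position of its column in the list
  \<open>cs\<close>; since \<open>cs\<close> is distinct, equal positions mean equal
  columns.\<close>

lemma
  fixes m As
  defines "M \<equiv> stack m As"
  shows partition_matrix_cup_mat: "partition_matrix m (cup_mat m As)"
    and row_index_cup_mat_eq_iff: "j < m \<Longrightarrow> j' < m \<Longrightarrow>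
      row_index (cup_mat m As) j = row_index (cup_mat m As) j' \<longleftrightarrow> col M j = col M j'"
proof -
  define cs where "cs = remdups (cols M)"
  have cup: "cup_mat m As = mat (length cs) m (\<lambda>(r, j). if cs ! r = col M j then 1 else 0)"
    by (simp add: cup_mat_def cs_def M_def Let_def)
  have cs: "distinct cs" "set cs = col M ` {..<m}"
    by (auto simp: cs_def cols_def M_def)
  have ex1: "\<exists>!i. i < length cs \<and> cs ! i = col M j" if "j < m" for j
    using cs that distinct_Ex1[of cs "col M j"] by auto
  show p: "partition_matrix m (cup_mat m As)"
    unfolding partition_matrix_def
  proof (intro conjI allI impI)
    show "elements_mat (cup_mat m As) \<subseteq> {0, 1}"
      by (auto simp: elements_mat_def cup)
    show "\<exists>!i. i < dim_row (cup_mat m As) \<and> cup_mat m As $$ (i, j) = 1" if "j < m" for j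
    proof -
      have "(i < dim_row (cup_mat m As) \<and> cup_mat m As $$ (i, j) = 1) \<longleftrightarrow>
        (i < length cs \<and> cs ! i = col M j)" for i
        using that by (auto simp: cup split: if_splits)
      then show ?thesis using ex1[OF that] by simp
    qed
    show "row (cup_mat m As) i \<noteq> 0\<^sub>v m" if "i < dim_row (cup_mat m As)" for i
    proof -
      have i: "i < length cs" using that by (simp add: cup)
      then have "cs ! i \<in> col M ` {..<m}" using cs(2) nth_mem by blast
      then obtain j where "j < m" "cs ! i = col M j" by auto
      then have "row (cup_mat m As) i $ j \<noteq> 0\<^sub>v m $ j" using i by (simp add: cup)
      then show ?thesis by metis
    qed
  qed (simp add: cup)
  have "cs ! row_index (cup_mat m As) j = col M j" "row_index (cup_mat m As) j < length cs"
    if "j < m" for j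
    using row_index_less[OF p that] partition_matrix_entry[OF p that row_index_less[OF p that]] that
    by (auto simp: cup split: if_splits)
  then show "row_index (cup_mat m As) j = row_index (cup_mat m As) j' \<longleftrightarrow> col M j = col M j'"
    if "j < m" "j' < m"
    using that cs(1) by (metis distinct_conv_nth)
qed

lemma well_connected_pair:
  "well_connected m [B, C] \<longleftrightarrow>
    (\<forall>u<dim_row C. \<forall>j\<in>row_support C u. \<forall>j'\<in>row_support C u.
      real (col_count (stack m [B, C]) j) / real (col_count (stack m [B]) j) =
      real (col_count (stack m [B, C]) j') / real (col_count (stack m [B]) j'))"
proof -
  have "{1..<length [B, C]} = {1}" by auto
  then show ?thesis unfolding well_connected_def by simp
qed

text \<open>Combinations are indexed by a family instead of a set of vectors, because different
  partitions may share equal rows.\<close>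

lemma (in vec_space) sum_in_span:
  assumes "W \<subseteq> carrier_vec n" "finite I" "\<And>x. x \<in> I \<Longrightarrow> u x \<in> span W"
  shows "vec n (\<lambda>j. \<Sum>x\<in>I. c x * u x $ j) \<in> span W"
  using assms(2,3)
proof (induction I rule: finite_induct)
  case empty
  have "vec n (\<lambda>j. \<Sum>x\<in>{}. c x * u x $ j) = 0\<^sub>v n" by auto
  then show ?case using span_zero[of W] by simp
next
  case (insert x I)
  then have "u x \<in> carrier_vec n" using span_closed[of W "u x"] assms(1) by simp
  then have "vec n (\<lambda>j. \<Sum>x\<in>insert x I. c x * u x $ j) =
    c x \<cdot>\<^sub>v u x + vec n (\<lambda>j. \<Sum>x\<in>I. c x * u x $ j)"
    using insert.hyps by (intro eq_vecI) auto
  moreover have "c x \<cdot>\<^sub>v u x \<in> span W"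
    using insert.prems assms(1) by (intro smult_in_span) auto
  ultimately show ?case
    using insert.IH insert.prems span_add1[OF _ \<open>c x \<cdot>\<^sub>v u x \<in> span W\<close>] assms(1) by simp
qed

section \<open>From matrices to row labels\<close>

locale multipartition =
  fixes m :: nat and As :: "real mat list" and d :: "real vec"
  assumes multipartition: "multipartition_matrix m As"
    and data: "d \<in> open_simplex m"
begin

sublocale labelled_data m "\<lambda>l. row_index (As ! l)" "\<lambda>j. d $ j" .

lemma partition_nth: "l < length As \<Longrightarrow> partition_matrix m (As ! l)"
  using multipartition by (simp add: multipartition_matrix_def)

lemma partition_take: "\<forall>A\<in>set (take l As). partition_matrix m A"
  using multipartition by (auto simp: multipartition_matrix_def dest: in_set_takeD)

lemma ball_set_take: "l \<le> length As \<Longrightarrow> (\<forall>A\<in>set (take l As). P A) \<longleftrightarrow> (\<forall>n<l. P (As ! n))"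
  by (simp add: all_set_conv_all_nth)

lemma col_count_take:
  assumes "l \<le> length As" "j < m"
  shows "col_count (stack m (take l As)) j = card (cell l j)"
  unfolding col_count_stack[OF partition_take assms(2)] cell_def ball_set_take[OF assms(1)] ..

text \<open>Rows are indicators of labels, so their combinations are sums of functions of the
  labels. For \<open>l > 0\<close> the constant term adds nothing, as the rows of one partition sum
  to the all-ones vector.\<close>

lemma rowspan_stack_iff:
  assumes l: "0 < l" "l \<le> length As" and v: "v \<in> carrier_vec m"
  shows "v \<in> rowspan m (stack m (take l As)) \<longleftrightarrow> additive l (\<lambda>j. v $ j)"
proof -
  define W where "W = set (rows (stack m (take l As)))"
  have W_eq: "W = (\<Union>A\<in>set (take l As). row A ` {..<dim_row A})"
    unfolding W_def by (rule set_rows_stack[OF partition_take])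
  have W: "W \<subseteq> carrier_vec m"
  proof -
    have "row A i \<in> carrier_vec m" if "A \<in> set (take l As)" for A i
    proof -
      have "dim_col A = m"
        using partition_take[of l] that unfolding partition_matrix_def by blast
      then show ?thesis using row_carrier[of A i] by simp
    qed
    then show ?thesis unfolding W_eq by blast
  qed
  have set_take: "set (take l As) = (!) As ` {..<l}"
    using nth_image[OF l(2)] by (simp add: lessThan_atLeast0)
  have entry: "row (As ! n) i $ j = (if row_index (As ! n) j = i then 1 else 0)"
    if "n < l" "i < dim_row (As ! n)" "j < m" for n i j
  proof -
    have "partition_matrix m (As ! n)" using that l by (intro partition_nth) simp
    then show ?thesis
      using that partition_matrix_entry[of m "As ! n" j i] by (simp add: partition_matrix_def)
  qed
  interpret vec_space "TYPE(real)" m .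
  have "v \<in> span W \<longleftrightarrow> additive l (\<lambda>j. v $ j)"
  proof
    assume "v \<in> span W"
    then obtain a X where X: "v = lincomb a X" "finite X" "X \<subseteq> W" using in_spanE by blast
    have "additive l (\<lambda>j. x $ j)" if x: "x \<in> X" for x
    proof -
      obtain n i where ni: "n < l" "i < dim_row (As ! n)" "x = row (As ! n) i"
        using x X(3) unfolding W_eq set_take by auto
      have "(\<Sum>n'<l. if n' = n \<and> row_index (As ! n') j = i then 1 else 0) = x $ j"
        if "j < m" for j
      proof -
        have "(\<Sum>n'<l. if n' = n \<and> row_index (As ! n') j = i then 1 else 0) =
          (\<Sum>n'<l. if n' = n then x $ j else 0)"
          using ni that by (intro sum.cong) (auto simp: entry)
        then show ?thesis using ni(1) by simp
      qed
      then show ?thesis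
        unfolding additive_def
        by (intro exI[of _ 0] exI[of _ "\<lambda>n' i'. if n' = n \<and> i' = i then 1 else 0"]) simp
    qed
    then have "additive l (\<lambda>j. \<Sum>x\<in>X. a x * x $ j)"
      using X(2) by (intro additive_sum additive_scale)
    moreover have "v $ j = (\<Sum>x\<in>X. a x * x $ j)" if "j < m" for j
      unfolding X(1) using that X(3) W by (intro lincomb_index) auto
    ultimately show "additive l (\<lambda>j. v $ j)" by (simp cong: additive_cong)
  next
    assume "additive l (\<lambda>j. v $ j)"
    then obtain c \<theta> where c: "\<And>j. j < m \<Longrightarrow> v $ j = c + (\<Sum>n<l. \<theta> n (row_index (As ! n) j))"
      unfolding additive_def by blast
    \<comment> \<open>The constant is absorbed into the coefficients of the first partition.\<close>
    define \<theta>' where "\<theta>' n i = (if n = 0 then c else 0) + \<theta> n i" for n i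
    define I where "I = (SIGMA n:{..<l}. {..<dim_row (As ! n)})"
    define u where "u = (\<lambda>(n, i). row (As ! n) i)"
    have "v = vec m (\<lambda>j. \<Sum>x\<in>I. (case x of (n, i) \<Rightarrow> \<theta>' n i) * u x $ j)"
    proof (rule eq_vecI)
      fix j assume "j < dim_vec (vec m (\<lambda>j. \<Sum>x\<in>I. (case x of (n, i) \<Rightarrow> \<theta>' n i) * u x $ j))"
      then have j: "j < m" by simp
      have "(\<Sum>x\<in>I. (case x of (n, i) \<Rightarrow> \<theta>' n i) * u x $ j) =
        (\<Sum>n<l. \<Sum>i<dim_row (As ! n). \<theta>' n i * row (As ! n) i $ j)"
        unfolding I_def u_def by (subst sum.Sigma) (auto simp: case_prod_beta)
      also have "\<dots> = (\<Sum>n<l. \<theta>' n (row_index (As ! n) j))"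
      proof (rule sum.cong[OF refl])
        fix n assume n: "n \<in> {..<l}"
        then have "row_index (As ! n) j < dim_row (As ! n)"
          using l j by (intro row_index_less[OF partition_nth]) auto
        moreover have "(\<Sum>i<dim_row (As ! n). \<theta>' n i * row (As ! n) i $ j) =
          (\<Sum>i<dim_row (As ! n). if i = row_index (As ! n) j then \<theta>' n i else 0)"
          using n j by (intro sum.cong) (auto simp: entry)
        ultimately show "(\<Sum>i<dim_row (As ! n). \<theta>' n i * row (As ! n) i $ j) =
          \<theta>' n (row_index (As ! n) j)"
          by simp
      qed
      also have "\<dots> = v $ j"
        using l(1) by (simp add: c[OF j] \<theta>'_def sum.distrib)
      finally show "v $ j = vec m (\<lambda>j. \<Sum>x\<in>I. (case x of (n, i) \<Rightarrow> \<theta>' n i) * u x $ j) $ j"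
        using j by simp
    qed (use v in auto)
    moreover have "u x \<in> span W" if "x \<in> I" for x
    proof (rule span_mem[OF _])
      show "u x \<in> W" using that unfolding W_eq set_take by (auto simp: I_def u_def)
    qed (use W in simp)
    ultimately show "v \<in> span W"
      using sum_in_span[OF W, of I u] by (simp add: I_def)
  qed
  then show ?thesis by (simp add: row_space_def W_def)
qed

lemma row_index_cup_mat_take_eq_iff:
  assumes "l \<le> length As" "j < m" "j' < m"
  shows "row_index (cup_mat m (take l As)) j' = row_index (cup_mat m (take l As)) j \<longleftrightarrow> j' \<in> cell l j"
  unfolding row_index_cup_mat_eq_iff[OF assms(3,2)] col_stack_eq_iff[OF partition_take assms(3,2)]
    ball_set_take[OF assms(1)]
  using assms(3) by (simp add: cell_def)

text \<open>The row of the refinement through \<open>j\<close> has the cell of \<open>j\<close> as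
  support; a row of the next partition meets it iff its label occurs there.\<close>

lemma connected_rows_cup_mat:
  assumes l: "l < length As" and j: "j < m"
  shows "connected_rows (cup_mat m (take l As)) (As ! l) (row_index (cup_mat m (take l As)) j) =
    flo l j"
proof -
  let ?B = "cup_mat m (take l As)"
  have B: "partition_matrix m ?B" by (rule partition_matrix_cup_mat)
  have C: "partition_matrix m (As ! l)" by (rule partition_nth[OF l])
  have "row_support ?B (row_index ?B j) = cell l j"
    unfolding row_support_partition_matrix[OF B row_index_less[OF B j]]
    using row_index_cup_mat_take_eq_iff[of l j] l j by (auto simp: cell_def[of l j])
  then have "connected_rows ?B (As ! l) (row_index ?B j) =
    {i. i < dim_row (As ! l) \<and> cell l j \<inter> {j'. j' < m \<and> row_index (As ! l) j' = i} \<noteq> {}}"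
    unfolding connected_rows_def using row_support_partition_matrix[OF C] by auto
  also have "\<dots> = flo l j"
    unfolding flo_def using row_index_less[OF C] by (auto simp: cell_def)
  finally show ?thesis .
qed

text \<open>Every row of the refinement passes through some column, so florets can be listed by
  columns.\<close>

lemma set_florets:
  assumes l: "l < length As"
  shows "set (florets (cup_mat m (take l As)) (As ! l)) = flo l ` {..<m}"
proof -
  let ?B = "cup_mat m (take l As)"
  have "set (florets ?B (As ! l)) = connected_rows ?B (As ! l) ` {..<dim_row ?B}"
    by (auto simp: florets_def)
  also have "\<dots> = connected_rows ?B (As ! l) ` row_index ?B ` {..<m}"
    by (simp add: row_index_image[OF partition_matrix_cup_mat])
  also have "\<dots> = flo l ` {..<m}"
    using connected_rows_cup_mat[OF l] by (auto simp: image_image)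
  finally show ?thesis .
qed

end

section \<open>The GRIP in terms of labels, and the estimate\<close>

locale grip_multipartition = multipartition +
  assumes grip: "grip m As"
begin

lemma grip_flo_disj:
  assumes "l < length As" "j < m" "j' < m"
  shows "flo l j \<inter> flo l j' = {} \<or> flo l j = flo l j'"
proof (cases "l = 0")
  case True
  then show ?thesis by (simp add: flo_def)
next
  case False
  let ?B = "cup_mat m (take l As)"
  have "floret_condition ?B (As ! l)"
    using grip False assms(1) by (auto simp: grip_def Let_def)
  then show ?thesis
    unfolding floret_condition_def
    using row_index_less[OF partition_matrix_cup_mat] assms connected_rows_cup_mat[OF assms(1)]
    by metis
qed

text \<open>Stacking the refinement of the first \<open>l\<close> partitions with the next one
  yields the same column classes as the first \<open>l + 1\<close> partitions, so the column counts
  of the pair are cell sizes.\<close>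

lemma grip_card_ratio:
  assumes l: "l < length As" and j: "j < m" "j' < m" and eq: "row_index (As ! l) j = row_index (As ! l) j'"
  shows "real (card (cell (Suc l) j)) / real (card (cell l j)) =
    real (card (cell (Suc l) j')) / real (card (cell l j'))"
proof (cases "l = 0")
  case True
  then show ?thesis using eq by (simp add: cell_def)
next
  case False
  let ?B = "cup_mat m (take l As)"
  let ?C = "As ! l"
  have B: "partition_matrix m ?B" by (rule partition_matrix_cup_mat)
  have C: "partition_matrix m ?C" by (rule partition_nth[OF l])
  have row_B: "row_index ?B i' = row_index ?B i \<longleftrightarrow> i' \<in> cell l i" if "i < m" "i' < m" for i i'
    using row_index_cup_mat_take_eq_iff[of l i i'] l that by simp
  have count_B: "col_count (stack m [?B]) i = card (cell l i)" if "i < m" for i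
  proof -
    have "col_count (stack m [?B]) i =
      card {i'. i' < m \<and> (\<forall>A\<in>set [?B]. row_index A i' = row_index A i)}"
      using B that by (intro col_count_stack) auto
    also have "{i'. i' < m \<and> (\<forall>A\<in>set [?B]. row_index A i' = row_index A i)} = cell l i"
      using row_B[OF that] by auto (auto simp: cell_def)
    finally show ?thesis .
  qed
  have count_BC: "col_count (stack m [?B, ?C]) i = card (cell (Suc l) i)" if "i < m" for i
  proof -
    have "col_count (stack m [?B, ?C]) i =
      card {i'. i' < m \<and> (\<forall>A\<in>set [?B, ?C]. row_index A i' = row_index A i)}"
      using B C that by (intro col_count_stack) auto
    also have "{i'. i' < m \<and> (\<forall>A\<in>set [?B, ?C]. row_index A i' = row_index A i)} = cell (Suc l) i"
      using row_B[OF that] by (auto simp: cell_Suc) (auto simp: cell_def)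
    finally show ?thesis .
  qed
  have "well_connected m [?B, ?C]"
    using grip False l by (auto simp: grip_def Let_def)
  note ratio = this[unfolded well_connected_pair]
  have u: "row_index ?C j < dim_row ?C" by (rule row_index_less[OF C j(1)])
  have "j \<in> row_support ?C (row_index ?C j)" "j' \<in> row_support ?C (row_index ?C j)"
    unfolding row_support_partition_matrix[OF C u] using j eq by simp_all
  then have
    "real (col_count (stack m [?B, ?C]) j) / real (col_count (stack m [?B]) j) =
     real (col_count (stack m [?B, ?C]) j') / real (col_count (stack m [?B]) j')"
    using ratio u by blast
  then show ?thesis using j by (simp add: count_B count_BC)
qed

text \<open>The floret indicator is a row of \<open>cap_mat\<close>, which the GRIP places in the
  earlier row span.\<close>

lemma grip_flo_additive:
  assumes l: "l < length As" and j': "j' < m"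
  shows "additive l (\<lambda>j. if row_index (As ! l) j \<in> flo l j' then 1 else 0)"
proof (cases "l = 0")
  \<comment> \<open>For \<open>l = 0\<close> the floret contains every label that occurs, so the
    indicator is the constant 1.\<close>
  case True
  then show ?thesis
    by (auto simp: additive_def flo_def intro!: exI[of _ 1])
next
  case False
  let ?B = "cup_mat m (take l As)"
  let ?C = "As ! l"
  have dim: "dim_col ?C = m" using partition_nth[OF l] by (simp add: partition_matrix_def)
  have "flo l j' \<in> set (florets ?B ?C)" using set_florets[OF l] j' by simp
  then obtain t where t: "t < length (florets ?B ?C)" "florets ?B ?C ! t = flo l j'"
    by (auto simp: in_set_conv_nth)
  let ?v = "row (cap_mat ?B ?C) t"
  have "?v \<in> set (rows (cap_mat ?B ?C))" using t(1) by (simp add: rows_def cap_mat_def)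
  then have v: "?v \<in> rowspan m (stack m (take l As))"
    using grip False l by (auto simp: grip_def Let_def)
  have entry: "?v $ j = (if row_index ?C j \<in> flo l j' then 1 else 0)" if "j < m" for j
    using t dim that by (simp add: cap_mat_def)
  have "dim_vec ?v = m" using dim by (simp add: cap_mat_def)
  then have "?v \<in> carrier_vec m" by (rule carrier_vecI)
  with v have "additive l (\<lambda>j. ?v $ j)"
    using False l by (intro iffD1[OF rowspan_stack_iff]) auto
  then show ?thesis using entry by (simp cong: additive_cong)
qed

sublocale grip_data m "\<lambda>l. row_index (As ! l)" "\<lambda>j. d $ j" "length As"
proof unfold_locales
  show "0 < d $ j" if "j < m" for j using data that by (simp add: open_simplex_def)
  show "(\<Sum>j<m. d $ j) = 1" using data by (simp add: open_simplex_def)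
qed (fact grip_flo_disj grip_card_ratio grip_flo_additive)+

text \<open>For \<open>l = 0\<close> all row indices occur as labels; otherwise disjointness makes
  the floret containing the label unique.\<close>

lemma floret_of_eq:
  assumes l: "l < length As" and j: "j < m"
  shows "floret_of m As l (row_index (As ! l) j) = flo l j"
proof (cases "l = 0")
  case True
  then show ?thesis
    using row_index_image[OF partition_nth[OF l]] by (simp add: floret_of_def flo_def)
next
  case False
  have "(THE F. F \<in> flo l ` {..<m} \<and> row_index (As ! l) j \<in> F) = flo l j"
    using in_flo_iff[OF l j] j by (intro the_equality) auto
  then show ?thesis using False by (simp add: floret_of_def set_florets[OF l])
qed

lemma est_eq:
  assumes "j < m"
  shows "est (length As) j = 1 / real (col_count (stack m As) j) *
       (\<Prod>l<length As. (row (As ! l) (row_index (As ! l) j) \<bullet> d) /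
          (\<Sum>i \<in> floret_of m As l (row_index (As ! l) j). row (As ! l) i \<bullet> d))"
proof -
  have dc: "d \<in> carrier_vec m" using data by (simp add: open_simplex_def)
  have row: "row (As ! l) i \<bullet> d = marg l i" if "l < length As" "i < dim_row (As ! l)" for l i
    using row_scalar_prod_partition_matrix[OF partition_nth[OF that(1)] that(2) dc]
    by (simp add: marg_def)
  have flo_sub: "i < dim_row (As ! l)" if "l < length As" "i \<in> flo l j" for l i
    using that row_index_less[OF partition_nth[OF that(1)]] by (auto simp: flo_def cell_def)
  show ?thesis
    unfolding est_def
  proof (rule arg_cong2[where f = "(*)"])
    show "1 / real (card (cell (length As) j)) = 1 / real (col_count (stack m As) j)"
      using col_count_take[OF order_refl assms] by simp
    show "(\<Prod>l<length As. marg l (row_index (As ! l) j) / fmarg l j) =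
      (\<Prod>l<length As. (row (As ! l) (row_index (As ! l) j) \<bullet> d) /
          (\<Sum>i \<in> floret_of m As l (row_index (As ! l) j). row (As ! l) i \<bullet> d))"
    proof (rule prod.cong[OF refl])
      fix l assume "l \<in> {..<length As}"
      then have l: "l < length As" by simp
      have "(\<Sum>i \<in> floret_of m As l (row_index (As ! l) j). row (As ! l) i \<bullet> d) = fmarg l j"
        unfolding floret_of_eq[OF l assms] fmarg_def
        using l by (intro sum.cong row flo_sub) auto
      then show "marg l (row_index (As ! l) j) / fmarg l j =
        (row (As ! l) (row_index (As ! l) j) \<bullet> d) /
          (\<Sum>i \<in> floret_of m As l (row_index (As ! l) j). row (As ! l) i \<bullet> d)"
        using row[OF l row_index_less[OF partition_nth[OF l] assms]] by simp
    qed
  qed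
qed

lemma model_iff:
  "p \<in> model m As \<longleftrightarrow> p \<in> open_simplex m \<and> additive (length As) (\<lambda>j. ln (p $ j))"
proof -
  have "map_vec ln p \<in> rowspan m (stack m As) \<longleftrightarrow> additive (length As) (\<lambda>j. ln (p $ j))"
    if "p \<in> open_simplex m"
  proof -
    have p: "p \<in> carrier_vec m" using that by (simp add: open_simplex_def)
    have "0 < length As" using multipartition by (simp add: multipartition_matrix_def)
    from rowspan_stack_iff[OF this order_refl, of "map_vec ln p"] p
    show ?thesis by (simp cong: additive_cong)
  qed
  then show ?thesis by (auto simp: model_def)
qed

lemma likelihood_eq_exp:
  assumes "p \<in> open_simplex m"
  shows "likelihood d p = exp (\<Sum>j<m. d $ j * ln (p $ j))"
  using assms data unfolding likelihood_def exp_sum[OF finite_lessThan]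
  by (intro prod.cong) (auto simp: open_simplex_def powr_def)

text \<open>The estimate lies in the model and strictly beats every other point of it, which gives
  existence and uniqueness together.\<close>

lemma is_mle_iff: "is_mle m As d p \<longleftrightarrow> p = vec m (est (length As))"
proof -
  let ?p = "vec m (est (length As))"
  have p_simplex: "?p \<in> open_simplex m"
    by (simp add: open_simplex_def est_pos est_sum)
  have p: "?p \<in> model m As"
    using p_simplex additive_ln_est[OF order_refl] by (simp add: model_iff cong: additive_cong)
  have less: "likelihood d q < likelihood d ?p" if q: "q \<in> model m As" "q \<noteq> ?p" for q
  proof -
    have qs: "q \<in> open_simplex m" and qa: "additive (length As) (\<lambda>j. ln (q $ j))"
      using q by (auto simp: model_iff)
    obtain j0 where "j0 < m" "q $ j0 \<noteq> est (length As) j0"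
      using qs q(2) by (auto simp: open_simplex_def vec_eq_iff)
    then have "(\<Sum>j<m. d $ j * ln (q $ j)) < (\<Sum>j<m. d $ j * ln (est (length As) j))"
      using qs qa by (intro est_maximises) (auto simp: open_simplex_def)
    then show ?thesis by (simp add: likelihood_eq_exp[OF qs] likelihood_eq_exp[OF p_simplex])
  qed
  show ?thesis
    unfolding is_mle_def is_arg_max_def using p less by (metis less_asym)
qed

end

theorem corollary3p18:
  fixes As :: "real mat list" and m k :: nat and d :: "real vec"
  assumes "multipartition_matrix m As" and "length As = k"
    and "grip m As"
    and "d \<in> open_simplex m"
  shows "(\<exists>!p. is_mle m As d p) \<and>
    (\<forall>j<m. mle m As d $ j =
       1 / real (col_count (stack m As) j) *
       (\<Prod>l<k. (row (As ! l) (row_index (As ! l) j) \<bullet> d) /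
          (\<Sum>i \<in> floret_of m As l (row_index (As ! l) j). row (As ! l) i \<bullet> d)))"
proof -
  interpret grip_multipartition m As d
    using assms by unfold_locales
  \<comment> \<open>The equivalence \<open>is_mle_iff\<close> also evaluates the definite
    description in \<open>mle\<close>.\<close>
  show ?thesis
    using assms(2) est_eq by (auto simp: is_mle_iff mle_def)
qed

end
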